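(* Let $\tau$ be a primitive substitution prolongable on a letter $a$ and $\mathbf{x}=\tau^\omega(a)$. If $\tau_2$ is ultimately Pisot, then for each $k\ge1$ the $k$-abelian complexity $(\rho^k_{\mathbf{x}}(n))_{n\ge0}$ is bounded.
   Context: $u\sim_k v$ if $|u|_w=|v|_w$ for all words $w$ of length at most $k$; $\rho^k_{\mathbf{x}}(n)$ is the number of $\sim_k$-classes of length-$n$ factors of $\mathbf{x}$. Primitive: the incidence matrix (entry $(i,j)$ equal to $|\tau(a_i)|_{a_j}$) is primitive. Ultimately Pisot: the characteristic polynomial of the incidence matrix is $X^mP_\theta(X)$, $m\ge0$, $P_\theta$ the minimal polynomial of a Pisot number $\theta$ (algebraic integer $>1$ whose other conjugates have modulus $<1$). $\tau_2$: number the length-$2$ factors of $\mathbf{x}$ as $1,\dots,p$ in order of first occurrence via a bijection $\Theta_2$; for $\ell$ with $u=\Theta_2^{-1}(\ell)$ and $m'=|\tau(u[0])|$, $\tau_2(\ell)=\Theta_2(w_0)\cdots\Theta_2(w_{m'-1})$ with $w_j$ the length-$2$ factor of $\tau(u)$ at position $j$. *)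

theory Defs
  imports "Jordan_Normal_Form.Char_Poly" "HOL-Computational_Algebra.Polynomial_Factorial"
begin

definition is_subst :: "nat \<Rightarrow> (nat \<Rightarrow> nat list) \<Rightarrow> bool" where
  "is_subst d \<tau> \<longleftrightarrow> (\<forall>b<d. \<tau> b \<noteq> [] \<and> set (\<tau> b) \<subseteq> {0..<d})"

definition subst_word :: "(nat \<Rightarrow> nat list) \<Rightarrow> nat list \<Rightarrow> nat list" where
  "subst_word \<tau> w = concat (map \<tau> w)"

definition incidence_mat :: "nat \<Rightarrow> (nat \<Rightarrow> nat list) \<Rightarrow> int mat" where
  "incidence_mat d \<tau> = mat d d (\<lambda>(i,j). int (count_list (\<tau> i) j))"

definition primitive_mat :: "int mat \<Rightarrow> bool" where
  "primitive_mat M \<longleftrightarrow> (\<exists>k>0. \<forall>i<dim_row M. \<forall>j<dim_col M. (M ^\<^sub>m k) $$ (i,j) > 0)"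

definition primitive_subst :: "nat \<Rightarrow> (nat \<Rightarrow> nat list) \<Rightarrow> bool" where
  "primitive_subst d \<tau> \<longleftrightarrow> primitive_mat (incidence_mat d \<tau>)"

definition prolongable :: "(nat \<Rightarrow> nat list) \<Rightarrow> nat \<Rightarrow> bool" where
  "prolongable \<tau> a \<longleftrightarrow> (\<exists>u. u \<noteq> [] \<and> \<tau> a = a # u)"

definition is_fixpoint_word :: "(nat \<Rightarrow> nat list) \<Rightarrow> nat \<Rightarrow> (nat \<Rightarrow> nat) \<Rightarrow> bool" where
  "is_fixpoint_word \<tau> a x \<longleftrightarrow>
     (\<forall>n i. i < length ((subst_word \<tau> ^^ n) [a]) \<longrightarrow> x i = ((subst_word \<tau> ^^ n) [a]) ! i)"

definition factor :: "(nat \<Rightarrow> nat) \<Rightarrow> nat \<Rightarrow> nat \<Rightarrow> nat list" where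
  "factor x i n = map x [i..<i+n]"

definition factors :: "(nat \<Rightarrow> nat) \<Rightarrow> nat \<Rightarrow> nat list set" where
  "factors x n = {factor x i n | i. True}"

definition int_min_poly :: "int poly \<Rightarrow> real \<Rightarrow> bool" where
  "int_min_poly P \<theta> \<longleftrightarrow> lead_coeff P = 1 \<and> irreducible P \<and> poly (map_poly of_int P) \<theta> = 0"

definition pisot :: "real \<Rightarrow> bool" where
  "pisot \<theta> \<longleftrightarrow> \<theta> > 1 \<and> (\<exists>P. int_min_poly P \<theta> \<and>
     (\<forall>z::complex. poly (map_poly of_int P) z = 0 \<and> z \<noteq> complex_of_real \<theta> \<longrightarrow> cmod z < 1))"

definition ultimately_pisot_mat :: "int mat \<Rightarrow> bool" where
  "ultimately_pisot_mat M \<longleftrightarrow>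
     (\<exists>m P \<theta>. pisot \<theta> \<and> int_min_poly P \<theta> \<and> char_poly M = monom 1 m * P)"

definition ultimately_pisot :: "nat \<Rightarrow> (nat \<Rightarrow> nat list) \<Rightarrow> bool" where
  "ultimately_pisot d \<tau> \<longleftrightarrow> ultimately_pisot_mat (incidence_mat d \<tau>)"

(* tau_2: length-2 factors numbered 0..p-1 in order of first occurrence *)
definition first_occ :: "(nat \<Rightarrow> nat) \<Rightarrow> nat list \<Rightarrow> nat" where
  "first_occ x w = (LEAST i. factor x i (length w) = w)"

definition Theta2 :: "(nat \<Rightarrow> nat) \<Rightarrow> nat list \<Rightarrow> nat" where
  "Theta2 x w = card {v \<in> factors x 2. first_occ x v < first_occ x w}"

definition num_factors2 :: "(nat \<Rightarrow> nat) \<Rightarrow> nat" where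
  "num_factors2 x = card (factors x 2)"

definition tau2 :: "(nat \<Rightarrow> nat list) \<Rightarrow> (nat \<Rightarrow> nat) \<Rightarrow> nat \<Rightarrow> nat list" where
  "tau2 \<tau> x l =
     (let u = the_inv_into (factors x 2) (Theta2 x) l;
          tu = subst_word \<tau> u
      in map (\<lambda>j. Theta2 x (take 2 (drop j tu))) [0..<length (\<tau> (u ! 0))])"

definition occ :: "nat list \<Rightarrow> nat list \<Rightarrow> nat" where
  "occ u w = card {i. i + length w \<le> length u \<and> take (length w) (drop i u) = w}"

definition k_abelian_eq :: "nat \<Rightarrow> nat list \<Rightarrow> nat list \<Rightarrow> bool" where
  "k_abelian_eq k u v \<longleftrightarrow> (\<forall>w. length w \<le> k \<longrightarrow> occ u w = occ v w)"

definition k_abelian_complexity :: "nat \<Rightarrow> (nat \<Rightarrow> nat) \<Rightarrow> nat \<Rightarrow> nat" where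
  "k_abelian_complexity k x n =
     card (factors x n // {(u,v). u \<in> factors x n \<and> v \<in> factors x n \<and> k_abelian_eq k u v})"

end

theory Submission
  imports Defs "Jordan_Normal_Form.Schur_Decomposition"
begin

text \<open>Code \<open>x\<close> by its overlapping pairs, \<open>y i = \<Theta>\<^sub>2 (x i x (i+1))\<close>; this is a fixed point of \<open>\<tau>\<^sub>2\<close>.
  For a weight \<open>f\<close> on letters, desubstituting a prefix of \<open>y\<close> bounds its total weight by a constant
  times \<open>\<Sum>n. \<parallel>M ^ n f\<parallel>\<close>, with \<open>M\<close> the incidence matrix of \<open>\<tau>\<^sub>2\<close>. Since all eigenvalues of
  \<open>M\<close> except one simple one have modulus below 1, this series is bounded on a hyperplane of weights. The constant
  weight 1 lies outside it, as its prefix sums are unbounded, so every weight is a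
  constant plus an element of the hyperplane, and all prefix sums over \<open>y\<close> are linear up to a bounded error.

  For arbitrary \<open>k\<close> no spectral information on \<open>\<tau>\<^sub>k\<close> is needed: if \<open>\<tau> ^ n\<close> maps every letter
  to a word of length at least \<open>k\<close>, then the number of occurrences of a word of length at most \<open>k\<close> that start
  in the block \<open>\<tau> ^ n (x i)\<close> depends only on \<open>y i\<close>. Hence such counts are linear up to a bounded error too, so
  over all factors of \<open>x\<close> of a given length they take boundedly many values.\<close>

section \<open>Spectrum of an ultimately Pisot matrix\<close>

text \<open>Pseudo-dividing \<open>P\<close> by a nonzero integer polynomial \<open>g\<close> of
  least degree vanishing at \<theta> leaves remainder 0. Being prime by unique factorization,
  \<open>P\<close> then divides \<open>g\<close>.\<close>

lemma int_min_poly_degree_le: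
  fixes P q :: "int poly" and \<theta> :: real
  assumes P: "int_min_poly P \<theta>" and q0: "q \<noteq> 0" and q\<theta>: "poly (map_poly of_int q) \<theta> = 0"
  shows "degree P \<le> degree q"
proof -
  define I where "I q \<longleftrightarrow> q \<noteq> 0 \<and> poly (map_poly of_int q) \<theta> = 0" for q :: "int poly"
  have irr: "irreducible P" and P\<theta>: "poly (map_poly of_int P) \<theta> = 0"
    using P by (auto simp: int_min_poly_def)
  have prime: "prime_elem P" using irr by (rule irreducible_imp_prime_elem)
  have "I q" using q0 q\<theta> by (simp add: I_def)
  then obtain g where g: "I g" and gmin: "\<And>h. I h \<Longrightarrow> degree g \<le> degree h"
    using ex_has_least_nat[of I q degree] by blast
  have g0: "g \<noteq> 0" and g\<theta>: "poly (map_poly of_int g) \<theta> = 0" using g by (auto simp: I_def)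
  obtain c s where c: "c \<noteq> 0" and cs: "Polynomial.smult c P = g * s + pseudo_mod P g"
    using pseudo_mod(1)[OF g0, of P] by auto
  have "poly (map_poly of_int (Polynomial.smult c P)) \<theta> = poly (map_poly of_int (g * s + pseudo_mod P g)) \<theta>"
    using cs by simp
  then have "poly (map_poly of_int (pseudo_mod P g)) \<theta> = 0"
    using P\<theta> g\<theta> by (simp add: of_int_hom.map_poly_hom_add of_int_hom.map_poly_hom_smult of_int_poly_hom.hom_mult)
  then have r0: "pseudo_mod P g = 0"
    using gmin[of "pseudo_mod P g"] pseudo_mod(2)[OF g0, of P] unfolding I_def by linarith
  then have eq: "Polynomial.smult c P = g * s" using cs by simp
  then have "P dvd g * s" by (metis dvd_smult dvd_refl)
  then have "P dvd g \<or> P dvd s" using prime by (simp add: prime_elem_dvd_mult_iff)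
  \<comment> \<open>Otherwise cancelling \<open>P\<close> turns \<open>g\<close> into a nonzero
    constant, which has no root.\<close>
  moreover have "\<not> P dvd s"
  proof
    assume "P dvd s"
    then obtain t where t: "s = P * t" by (elim dvdE)
    have "P * [:c:] = P * (g * t)" using eq t by (simp add: algebra_simps)
    moreover have "P \<noteq> 0" using irr by auto
    ultimately have "[:c:] = g * t" by (metis mult_left_cancel)
    then have "degree (g * t) = 0" "g * t \<noteq> 0" using c by (metis degree_pCons_0, metis pCons_eq_0_iff)
    then have "degree g = 0" using g0 by (auto simp: degree_mult_eq)
    then obtain b where b: "g = [:b:]" by (elim degree_eq_zeroE)
    show False using g0 g\<theta> by (simp add: b map_poly_pCons)
  qed
  ultimately have "P dvd g" by simp
  then have "degree P \<le> degree g" using g0 by (rule dvd_imp_degree_le)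
  also have "\<dots> \<le> degree q" using gmin \<open>I q\<close> by blast
  finally show ?thesis .
qed

text \<open>The derivative is a nonzero integer polynomial of smaller degree, so minimality keeps it
  from vanishing at \<theta>.\<close>

lemma int_min_poly_simple_root:
  assumes P: "int_min_poly P \<theta>"
  shows "poly (pderiv (map_poly of_int P)) (complex_of_real \<theta>) \<noteq> 0"
proof
  assume *: "poly (pderiv (map_poly of_int P)) (complex_of_real \<theta>) = 0"
  have irr: "irreducible P" and P\<theta>: "poly (map_poly of_int P) \<theta> = 0" and lc: "lead_coeff P = 1"
    using P by (auto simp: int_min_poly_def)
  have deg: "degree P \<noteq> 0"
  proof
    assume "degree P = 0"
    then have "P = 1" using lc by (metis degree_eq_zeroE lead_coeff_pCons(2) one_pCons)
    then show False using irr by simp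
  qed
  then have nz: "pderiv P \<noteq> 0" by (simp add: pderiv_eq_0_iff)
  have "(map_poly of_int Q :: complex poly) = map_poly complex_of_real (map_poly of_int Q)" for Q
    by (simp add: map_poly_map_poly o_def)
  moreover have "pderiv (map_poly of_int P :: complex poly) = map_poly of_int (pderiv P)"
    by (simp add: of_int_hom.map_poly_pderiv)
  ultimately have "complex_of_real (poly (map_poly of_int (pderiv P)) \<theta>) = 0"
    using * by (simp add: of_real_hom.poly_map_poly)
  then have "poly (map_poly of_int (pderiv P)) \<theta> = 0" by simp
  from int_min_poly_degree_le[OF P nz this] show False
    using deg by (simp add: degree_pderiv)
qed

lemma prod_list_map_remove1:
  fixes f :: "'a \<Rightarrow> 'b :: comm_monoid_mult"
  shows "x \<in> set xs \<Longrightarrow> prod_list (map f xs) = prod_list (map f (remove1 x xs)) * f x"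
  by (induction xs) (auto simp: ac_simps)

text \<open>Apart from one copy of \<theta>, each eigenvalue is 0 or another conjugate of \<theta>.
  Listing \<theta> last prescribes its place on the diagonal of a Schur form.\<close>

lemma ultimately_pisot_factorization:
  fixes M :: "int mat"
  assumes M: "M \<in> carrier_mat p p" and up: "ultimately_pisot_mat M"
  obtains es \<theta> where "char_poly (map_mat complex_of_int M) = (\<Prod>e\<leftarrow>es @ [\<theta>]. [:- e, 1:])"
    and "\<And>e. e \<in> set es \<Longrightarrow> cmod e < 1"
proof -
  let ?A = "map_mat complex_of_int M"
  obtain m P \<theta> where pis: "pisot \<theta>" and imp: "int_min_poly P \<theta>" and cp: "char_poly M = monom 1 m * P"
    using up by (auto simp: ultimately_pisot_mat_def)
  obtain P' where P': "int_min_poly P' \<theta>"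
    and small': "\<And>z::complex. poly (map_poly of_int P') z = 0 \<Longrightarrow> z \<noteq> of_real \<theta> \<Longrightarrow> cmod z < 1"
    and th1: "\<theta> > 1" using pis by (auto simp: pisot_def)
  let ?\<theta> = "complex_of_real \<theta>" and ?P = "map_poly of_int P :: complex poly"
  \<comment> \<open>The two definitions each bring a minimal polynomial. Both are monic of least
    degree, so a nonzero difference would vanish at \<theta> with smaller degree.\<close>
  have PP: "P' = P"
  proof (rule ccontr)
    assume "P' \<noteq> P"
    then have ne: "P - P' \<noteq> 0" by simp
    have nz: "P \<noteq> 0" "P' \<noteq> 0" using imp P' by (auto simp: int_min_poly_def)
    have "degree P = degree P'"
      using int_min_poly_degree_le[OF imp nz(2)] int_min_poly_degree_le[OF P' nz(1)] imp P'
      by (simp add: int_min_poly_def)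
    moreover have "poly (map_poly of_int (P - P')) \<theta> = 0"
      using imp P' by (simp add: int_min_poly_def of_int_poly_hom.hom_minus)
    then have "degree P \<le> degree (P - P')" by (rule int_min_poly_degree_le[OF imp ne])
    moreover have "coeff (P - P') (degree P) = 0"
      using imp P' calculation(1) by (simp add: int_min_poly_def)
    ultimately have "P - P' = 0"
      by (metis degree_diff_le_max eq_zero_or_degree_less leading_coeff_0_iff le_antisym max.idem)
    then show False using ne by simp
  qed
  have small: "\<And>z::complex. poly ?P z = 0 \<Longrightarrow> z \<noteq> ?\<theta> \<Longrightarrow> cmod z < 1" using small' by (simp add: PP)
  have A: "?A \<in> carrier_mat p p" using M by simp
  obtain as where as: "char_poly ?A = (\<Prod>a\<leftarrow>as. [:- a, 1:])"
    using char_poly_factorized[OF A] by blast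
  have cpA: "char_poly ?A = monom 1 m * ?P"
    unfolding of_int_hom.char_poly_hom[OF M] cp
    by (simp add: of_int_poly_hom.hom_mult)
  have root: "poly ?P ?\<theta> = 0"
  proof -
    have "?P = map_poly complex_of_real (map_poly of_int P)" by (simp add: map_poly_map_poly o_def)
    then show ?thesis using imp by (simp add: int_min_poly_def of_real_hom.poly_map_poly)
  qed
  then have "poly (\<Prod>a\<leftarrow>as. [:- a, 1:]) ?\<theta> = 0"
    unfolding as[symmetric] cpA by simp
  then have mem: "?\<theta> \<in> set as" by (auto simp: poly_prod_list prod_list_zero_iff)
  let ?es = "remove1 ?\<theta> as"
  have prod: "(\<Prod>a\<leftarrow>as. [:- a, 1:]) = (\<Prod>a\<leftarrow>?es. [:- a, 1:]) * [:- ?\<theta>, 1:]"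
    by (rule prod_list_map_remove1[OF mem])
  show thesis
  proof (rule that[of ?es ?\<theta>])
    show "char_poly ?A = (\<Prod>e\<leftarrow>?es @ [?\<theta>]. [:- e, 1:])" using as prod by simp
    fix e assume e: "e \<in> set ?es"
    then have "e \<in> set as" by (meson notin_set_remove1)
    then have "poly (char_poly ?A) e = 0" unfolding as by (rule linear_poly_root)
    then have z: "e = 0 \<or> poly ?P e = 0" by (auto simp: cpA poly_monom)
    show "cmod e < 1"
    proof (cases "e = ?\<theta>")
      case False
      then show ?thesis using z small by auto
    next
      case True
      \<comment> \<open>A second copy of \<theta> would be a double root, but the derivative there
        is \<open>\<theta> ^ m\<close> times that of \<open>P\<close>, hence nonzero.\<close>
      have "poly (pderiv (char_poly ?A)) ?\<theta> = 0"
        using linear_poly_root[OF e] True unfolding as prod pderiv_mult by (simp add: pderiv_pCons)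
      then have "?\<theta> ^ m * poly (pderiv ?P) ?\<theta> = 0"
        using root by (simp add: cpA pderiv_mult poly_monom)
      then show ?thesis using int_min_poly_simple_root[OF imp] th1 by simp
    qed
  qed
qed

section \<open>The stable hyperplane\<close>

text \<open>The incidence matrix acting on weights as column vectors: if the letters of
  \<open>\<sigma> l\<close> are below \<open>p\<close>, the value at \<open>l\<close> is the total
  weight of the word \<open>\<sigma> l\<close>.\<close>

definition subst_op :: "nat \<Rightarrow> (nat \<Rightarrow> nat list) \<Rightarrow> (nat \<Rightarrow> complex) \<Rightarrow> nat \<Rightarrow> complex" where
  "subst_op p \<sigma> f l = (\<Sum>j<p. of_nat (count_list (\<sigma> l) j) * f j)"

definition l1norm :: "nat \<Rightarrow> (nat \<Rightarrow> complex) \<Rightarrow> real" where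
  "l1norm p f = (\<Sum>l<p. cmod (f l))"

text \<open>Bounded partial sums stand for convergence, as the terms are nonnegative.\<close>

definition summable_orbit :: "nat \<Rightarrow> (nat \<Rightarrow> nat list) \<Rightarrow> (nat \<Rightarrow> complex) \<Rightarrow> bool" where
  "summable_orbit p \<sigma> f \<longleftrightarrow> (\<exists>B. \<forall>N. (\<Sum>n<N. l1norm p ((subst_op p \<sigma> ^^ n) f)) \<le> B)"

lemma l1norm_nonneg: "0 \<le> l1norm p f"
  by (simp add: l1norm_def sum_nonneg)

lemma l1norm_add: "l1norm p (\<lambda>l. f l + g l) \<le> l1norm p f + l1norm p g"
  unfolding l1norm_def sum.distrib[symmetric] by (intro sum_mono norm_triangle_ineq)

lemma l1norm_scale: "l1norm p (\<lambda>l. c * f l) = cmod c * l1norm p f"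
  by (simp add: l1norm_def norm_mult sum_distrib_left)

lemma l1norm_cong: "(\<And>l. l < p \<Longrightarrow> f l = g l) \<Longrightarrow> l1norm p f = l1norm p g"
  by (simp add: l1norm_def)

lemma subst_op_cong: "(\<And>l. l < p \<Longrightarrow> f l = g l) \<Longrightarrow> subst_op p \<sigma> f = subst_op p \<sigma> g"
  by (auto simp: subst_op_def fun_eq_iff)

lemma subst_op_add: "subst_op p \<sigma> (\<lambda>l. f l + g l) = (\<lambda>l. subst_op p \<sigma> f l + subst_op p \<sigma> g l)"
  by (simp add: subst_op_def fun_eq_iff algebra_simps sum.distrib)

lemma subst_op_scale: "subst_op p \<sigma> (\<lambda>l. c * f l) = (\<lambda>l. c * subst_op p \<sigma> f l)"
  by (simp add: subst_op_def fun_eq_iff algebra_simps sum_distrib_left)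

lemma subst_op_pow_add:
  "(subst_op p \<sigma> ^^ n) (\<lambda>l. f l + g l) = (\<lambda>l. (subst_op p \<sigma> ^^ n) f l + (subst_op p \<sigma> ^^ n) g l)"
  by (induction n) (simp_all add: subst_op_add)

lemma subst_op_pow_scale:
  "(subst_op p \<sigma> ^^ n) (\<lambda>l. c * f l) = (\<lambda>l. c * (subst_op p \<sigma> ^^ n) f l)"
  by (induction n) (simp_all add: subst_op_scale)

lemma subst_op_pow_cong:
  assumes "\<And>l. l < p \<Longrightarrow> f l = g l" and "l < p"
  shows "(subst_op p \<sigma> ^^ n) f l = (subst_op p \<sigma> ^^ n) g l"
proof -
  have "\<forall>l<p. (subst_op p \<sigma> ^^ n) f l = (subst_op p \<sigma> ^^ n) g l"
    using assms(1)
  proof (induction n)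
    case (Suc n)
    have "subst_op p \<sigma> ((subst_op p \<sigma> ^^ n) f) = subst_op p \<sigma> ((subst_op p \<sigma> ^^ n) g)"
      by (rule subst_op_cong) (use Suc in blast)
    then show ?case by simp
  qed simp
  with assms(2) show ?thesis by blast
qed

lemma summable_orbit_cong:
  assumes "\<And>l. l < p \<Longrightarrow> f l = g l" and "summable_orbit p \<sigma> f"
  shows "summable_orbit p \<sigma> g"
proof -
  have "l1norm p ((subst_op p \<sigma> ^^ n) f) = l1norm p ((subst_op p \<sigma> ^^ n) g)" for n
    by (rule l1norm_cong) (rule subst_op_pow_cong[OF assms(1)])
  then show ?thesis using assms(2) by (simp add: summable_orbit_def)
qed

lemma summable_orbit_zero: "summable_orbit p \<sigma> (\<lambda>_. 0)"
proof -
  have "(subst_op p \<sigma> ^^ n) (\<lambda>_. 0) = (\<lambda>_. 0)" for n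
    by (induction n) (simp_all add: subst_op_def)
  then show ?thesis by (auto simp: summable_orbit_def l1norm_def)
qed

lemma summable_orbit_add:
  assumes "summable_orbit p \<sigma> f" and "summable_orbit p \<sigma> g"
  shows "summable_orbit p \<sigma> (\<lambda>l. f l + g l)"
proof -
  obtain B C where B: "\<And>N. (\<Sum>n<N. l1norm p ((subst_op p \<sigma> ^^ n) f)) \<le> B"
    and C: "\<And>N. (\<Sum>n<N. l1norm p ((subst_op p \<sigma> ^^ n) g)) \<le> C"
    using assms by (auto simp: summable_orbit_def)
  have "(\<Sum>n<N. l1norm p ((subst_op p \<sigma> ^^ n) (\<lambda>l. f l + g l))) \<le> B + C" for N
  proof -
    have "(\<Sum>n<N. l1norm p ((subst_op p \<sigma> ^^ n) (\<lambda>l. f l + g l)))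
        \<le> (\<Sum>n<N. l1norm p ((subst_op p \<sigma> ^^ n) f) + l1norm p ((subst_op p \<sigma> ^^ n) g))"
      unfolding subst_op_pow_add by (intro sum_mono l1norm_add)
    also have "\<dots> \<le> B + C" using add_mono[OF B C] by (simp add: sum.distrib)
    finally show ?thesis .
  qed
  then show ?thesis unfolding summable_orbit_def by blast
qed

lemma summable_orbit_scale:
  assumes "summable_orbit p \<sigma> f"
  shows "summable_orbit p \<sigma> (\<lambda>l. c * f l)"
proof -
  obtain B where B: "\<And>N. (\<Sum>n<N. l1norm p ((subst_op p \<sigma> ^^ n) f)) \<le> B"
    using assms by (auto simp: summable_orbit_def)
  have "(\<Sum>n<N. l1norm p ((subst_op p \<sigma> ^^ n) (\<lambda>l. c * f l))) \<le> cmod c * B" for N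
    using B[of N] by (simp add: subst_op_pow_scale l1norm_scale sum_distrib_left[symmetric] mult_left_mono)
  then show ?thesis unfolding summable_orbit_def by blast
qed

lemma summable_orbit_sum:
  "(\<And>i. i \<in> I \<Longrightarrow> summable_orbit p \<sigma> (f i)) \<Longrightarrow> summable_orbit p \<sigma> (\<lambda>l. \<Sum>i\<in>I. f i l)"
  by (induction I rule: infinite_finite_induct) (simp_all add: summable_orbit_zero summable_orbit_add)

text \<open>The norms along the orbit obey a recursion with contraction factor \<open>cmod c\<close>
  and a summable error from \<open>g\<close>; summing it bounds the series. The error term makes
  this fit triangular systems.\<close>

lemma summable_orbit_eigen:
  assumes c: "cmod c < 1"
    and eq: "\<And>l. l < p \<Longrightarrow> subst_op p \<sigma> f l = c * f l + g l"
    and g: "summable_orbit p \<sigma> g"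
  shows "summable_orbit p \<sigma> f"
proof -
  let ?T = "subst_op p \<sigma>"
  obtain B where B: "\<And>N. (\<Sum>n<N. l1norm p ((?T ^^ n) g)) \<le> B"
    using g by (auto simp: summable_orbit_def)
  let ?s = "\<lambda>n. l1norm p ((?T ^^ n) f)"
  let ?S = "\<lambda>N. \<Sum>n<N. ?s n"
  have step: "?s (Suc n) \<le> cmod c * ?s n + l1norm p ((?T ^^ n) g)" for n
  proof -
    have "?s (Suc n) = l1norm p ((?T ^^ n) (?T f))" by (simp add: funpow_swap1)
    also have "\<dots> = l1norm p ((?T ^^ n) (\<lambda>l. c * f l + g l))"
      by (rule l1norm_cong) (rule subst_op_pow_cong[OF eq])
    also have "\<dots> \<le> cmod c * ?s n + l1norm p ((?T ^^ n) g)"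
      unfolding subst_op_pow_add[of _ _ _ "\<lambda>l. c * f l"] subst_op_pow_scale l1norm_scale[symmetric]
      by (rule l1norm_add)
    finally show ?thesis .
  qed
  have "?S N \<le> (?s 0 + B) / (1 - cmod c)" for N
  proof -
    \<comment> \<open>With one term more, splitting off the first leaves \<open>N\<close> shifted
      terms, which the recursion compares with \<open>?S N\<close> itself.\<close>
    have "?S N \<le> ?S (Suc N)" by (simp add: l1norm_nonneg)
    also have "\<dots> = ?s 0 + (\<Sum>n<N. ?s (Suc n))" by (simp only: sum.lessThan_Suc_shift funpow_0)
    also have "\<dots> \<le> ?s 0 + (\<Sum>n<N. cmod c * ?s n + l1norm p ((?T ^^ n) g))"
      by (intro add_left_mono sum_mono step)
    also have "\<dots> \<le> ?s 0 + (cmod c * ?S N + B)"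
      using B[of N] by (simp add: sum.distrib sum_distrib_left)
    finally have "?S N * (1 - cmod c) \<le> ?s 0 + B" by (simp add: algebra_simps)
    then show ?thesis using c by (simp add: pos_le_divide_eq)
  qed
  then show ?thesis unfolding summable_orbit_def by blast
qed

text \<open>A Schur basis with the dominant eigenvalue placed last: its first \<open>p - 1\<close> columns
  span a stable hyperplane, and \<open>\<phi>\<close> is the last coordinate in that basis.\<close>

lemma stable_hyperplane:
  assumes "ultimately_pisot p \<sigma>"
  obtains \<phi> :: "(nat \<Rightarrow> complex) \<Rightarrow> complex"
  where "\<And>f g. \<phi> (\<lambda>l. f l + g l) = \<phi> f + \<phi> g" and "\<And>c f. \<phi> (\<lambda>l. c * f l) = c * \<phi> f"
    and "\<And>f. \<phi> f = 0 \<Longrightarrow> summable_orbit p \<sigma> f"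
proof -
  let ?M = "incidence_mat p \<sigma>"
  define A where "A = map_mat complex_of_int ?M"
  have M: "?M \<in> carrier_mat p p" by (simp add: incidence_mat_def)
  then have A: "A \<in> carrier_mat p p" by (simp add: A_def)
  obtain es \<theta> where cp: "char_poly A = (\<Prod>e\<leftarrow>es @ [\<theta>]. [:- e, 1:])"
    and small: "\<And>e. e \<in> set es \<Longrightarrow> cmod e < 1"
    using ultimately_pisot_factorization[OF M] assms unfolding ultimately_pisot_def A_def by blast
  obtain B S R where "schur_decomposition A (es @ [\<theta>]) = (B, S, R)"
    by (cases "schur_decomposition A (es @ [\<theta>])")
  from schur_decomposition[OF A cp this]
  have sim: "similar_mat_wit A B S R" and ut: "upper_triangular B" and dg: "diag_mat B = es @ [\<theta>]"
    by auto
  note wit = similar_mat_witD2[OF A sim]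
  have p: "p = Suc (length es)"
    using arg_cong[OF dg, of length] wit(5) by (simp add: diag_mat_def)
  \<comment> \<open>Read by columns, \<open>A * S = S * B\<close> says that \<open>A\<close> sends
    column \<open>j\<close> of \<open>S\<close> to \<open>B $$ (j, j)\<close> times itself plus a
    combination of earlier columns.\<close>
  have "A * S = S * B * R * S" using wit(3) by (rule arg_cong)
  also have "\<dots> = S * B * (R * S)"
    by (rule assoc_mult_mat[of _ p p _ p _ p]) (use wit(5-7) in simp_all)
  also have "\<dots> = S * B" unfolding wit(2) by (rule right_mult_one_mat[of _ p p]) (use wit(5-6) in simp)
  finally have AS: "A * S = S * B" .
  define s where "s j = (\<lambda>l. S $$ (l, j))" for j
  \<comment> \<open>Strong induction: the earlier columns form the summable error, and the diagonal
    entry belongs to \<open>es\<close>, so it lies inside the unit disc.\<close>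
  have summable_orbit_column: "summable_orbit p \<sigma> (s j)" if "j < length es" for j
    using that
  proof (induction j rule: less_induct)
    case (less j)
    have jp: "j < p" using less.prems p by simp
    have "B $$ (j, j) = diag_mat B ! j" using jp wit(5) by (simp add: diag_mat_def)
    also have "\<dots> = es ! j" using less.prems by (simp add: dg nth_append)
    finally have "B $$ (j, j) = es ! j" .
    then have small_j: "cmod (B $$ (j, j)) < 1" using small less.prems by simp
    show ?case
    proof (rule summable_orbit_eigen[OF small_j])
      show "summable_orbit p \<sigma> (\<lambda>l. \<Sum>i<j. B $$ (i, j) * s i l)"
        by (rule summable_orbit_sum, rule summable_orbit_scale) (use less in simp)
      fix l assume l: "l < p"
      have "subst_op p \<sigma> (s j) l = (A * S) $$ (l, j)"
        using l jp wit(4,6)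
        by (simp add: subst_op_def s_def A_def incidence_mat_def scalar_prod_def lessThan_atLeast0)
      also have "\<dots> = (\<Sum>i<p. B $$ (i, j) * s i l)"
        unfolding AS using l jp wit(5,6)
        by (simp add: s_def scalar_prod_def lessThan_atLeast0 mult.commute)
      also have "\<dots> = (\<Sum>i<Suc j. B $$ (i, j) * s i l)"
        using jp ut wit(5) by (intro sum.mono_neutral_right) (auto simp: upper_triangular_def)
      finally show "subst_op p \<sigma> (s j) l = B $$ (j, j) * s j l + (\<Sum>i<j. B $$ (i, j) * s i l)"
        by simp
    qed
  qed
  \<comment> \<open>As \<open>S * R\<close> is the identity, these are the coordinates of
    \<open>f\<close> in the basis of columns of \<open>S\<close>.\<close>
  define \<psi> where "\<psi> j f = (\<Sum>k<p. R $$ (j, k) * f k)" for j and f :: "nat \<Rightarrow> complex"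
  have expand: "f l = (\<Sum>j<p. \<psi> j f * s j l)" if l: "l < p" for f l
  proof -
    have "(\<Sum>j<p. \<psi> j f * s j l) = (\<Sum>j<p. \<Sum>k<p. S $$ (l, j) * R $$ (j, k) * f k)"
      by (simp add: \<psi>_def s_def sum_distrib_left sum_distrib_right algebra_simps)
    also have "\<dots> = (\<Sum>k<p. (\<Sum>j<p. S $$ (l, j) * R $$ (j, k)) * f k)"
      by (subst sum.swap) (simp add: sum_distrib_right)
    also have "\<dots> = (\<Sum>k<p. (S * R) $$ (l, k) * f k)"
      using l wit(6,7) by (intro sum.cong) (auto simp: scalar_prod_def lessThan_atLeast0)
    also have "\<dots> = (\<Sum>k<p. (if k = l then f k else 0))"
      unfolding wit(1) using l by (intro sum.cong) auto
    also have "\<dots> = f l" using l by simp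
    finally show ?thesis by simp
  qed
  show thesis
  proof (rule that[of "\<psi> (length es)"])
    fix f g :: "nat \<Rightarrow> complex" and c
    show "\<psi> (length es) (\<lambda>l. f l + g l) = \<psi> (length es) f + \<psi> (length es) g"
      by (simp add: \<psi>_def algebra_simps sum.distrib)
    show "\<psi> (length es) (\<lambda>l. c * f l) = c * \<psi> (length es) f"
      by (simp add: \<psi>_def algebra_simps sum_distrib_left)
    assume 0: "\<psi> (length es) f = 0"
    have "summable_orbit p \<sigma> (\<lambda>l. \<Sum>j<length es. \<psi> j f * s j l)"
      by (intro summable_orbit_sum summable_orbit_scale) (simp add: summable_orbit_column)
    moreover have "(\<Sum>j<length es. \<psi> j f * s j l) = f l" if "l < p" for l
      using expand[OF that, of f] 0 by (simp add: p)
    ultimately show "summable_orbit p \<sigma> f" by (rule summable_orbit_cong[rotated])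
  qed
qed

section \<open>Prefix sums over a fixed point\<close>

text \<open>Serves to cut a prefix of length \<open>N\<close> into \<open>m\<close> complete blocks
  and a shorter remainder.\<close>

lemma block_index:
  fixes s :: "nat \<Rightarrow> nat"
  assumes "s 0 = 0" and "\<And>m. s m < s (Suc m)"
  obtains m where "s m \<le> N" and "N < s (Suc m)"
proof -
  have "\<exists>m. s m \<le> N \<and> N < s (Suc m)"
  proof (induction N)
    case 0
    show ?case using assms by (metis le_zero_eq order_refl)
  next
    case (Suc N)
    then obtain m where m: "s m \<le> N" "N < s (Suc m)" by blast
    show ?case
    proof (cases "Suc N < s (Suc m)")
      case True
      then show ?thesis using m by (intro exI[of _ m]) simp
    next
      case False
      then have "Suc N = s (Suc m)" using m by simp
      then show ?thesis using assms(2) by (intro exI[of _ "Suc m"]) simp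
    qed
  qed
  then show thesis using that by blast
qed

lemma sum_list_count:
  fixes f :: "nat \<Rightarrow> 'b :: comm_semiring_1"
  shows "set w \<subseteq> {..<p} \<Longrightarrow> sum_list (map f w) = (\<Sum>b<p. of_nat (count_list w b) * f b)"
proof (induction w)
  case (Cons c w)
  have "(\<Sum>b<p. of_nat (count_list (c # w) b) * f b)
      = (\<Sum>b<p. (if b = c then f b else 0) + of_nat (count_list w b) * f b)"
    by (intro sum.cong) (auto simp: algebra_simps)
  also have "\<dots> = f c + (\<Sum>b<p. of_nat (count_list w b) * f b)"
    using Cons.prems by (simp add: sum.distrib)
  finally show ?case using Cons by simp
qed simp

lemma sum_lessThan_add:
  fixes f :: "nat \<Rightarrow> 'b :: comm_monoid_add"
  shows "(\<Sum>i<m + n. f i) = (\<Sum>i<m. f i) + (\<Sum>i<n. f (m + i))"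
  by (induction n) (simp_all add: ac_simps)

text \<open>An infinite word \<open>y\<close> fixed by \<sigma>, presented by the positions
  \<open>s m\<close> where the images of its letters begin. The assumptions on images concern only
  letters occurring in \<open>y\<close>.\<close>

locale fixed_blocks =
  fixes p K :: nat and \<sigma> :: "nat \<Rightarrow> nat list" and y s :: "nat \<Rightarrow> nat"
  assumes y_less: "y i < p"
    and s_0: "s 0 = 0"
    and s_Suc: "s (Suc m) = s m + length (\<sigma> (y m))"
    and y_block: "i < length (\<sigma> (y m)) \<Longrightarrow> y (s m + i) = \<sigma> (y m) ! i"
    and block_nonempty: "\<sigma> (y m) \<noteq> []"
    and block_le: "length (\<sigma> (y m)) \<le> K"
    and first_block: "2 \<le> length (\<sigma> (y 0))"
begin

text \<open>Desubstitution: summing block by block moves the substitution from the word onto the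
  weight.\<close>

lemma sum_blocks: "(\<Sum>i<s m. f (y i)) = (\<Sum>j<m. subst_op p \<sigma> f (y j))"
proof (induction m)
  case 0
  show ?case by (simp add: s_0)
next
  case (Suc m)
  let ?w = "\<sigma> (y m)"
  have w: "set ?w \<subseteq> {..<p}"
    using y_block[of _ m] y_less by (metis in_set_conv_nth lessThan_iff subsetI)
  have "(\<Sum>i<length ?w. f (y (s m + i))) = sum_list (map f ?w)"
    by (simp add: y_block sum_list_sum_nth lessThan_atLeast0)
  also have "\<dots> = subst_op p \<sigma> f (y m)"
    unfolding sum_list_count[OF w] subst_op_def ..
  finally show ?case using Suc by (simp add: s_Suc sum_lessThan_add)
qed

lemma norm_le_l1norm: "cmod (f (y i)) \<le> l1norm p f"
  unfolding l1norm_def using y_less by (intro member_le_sum) auto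

text \<open>The complete blocks of a prefix desubstitute to a shorter prefix with weight
  \<open>subst_op p \<sigma> f\<close>; the remainder costs at most \<open>K\<close> times the norm
  of \<open>f\<close>. Induction collects these costs into the series.\<close>

lemma norm_sum_le: "cmod (\<Sum>i<N. f (y i)) \<le> K * (\<Sum>n<N. l1norm p ((subst_op p \<sigma> ^^ n) f))"
proof (induction N arbitrary: f rule: less_induct)
  case (less N)
  let ?T = "subst_op p \<sigma>"
  show ?case
  proof (cases "N = 0")
    case False
    have s_less: "s m < s (Suc m)" for m using block_nonempty by (simp add: s_Suc)
    obtain m where m: "s m \<le> N" "N < s (Suc m)" using block_index[OF s_0 s_less] .
    \<comment> \<open>The long first block keeps \<open>s\<close> strictly ahead of the identity, so
      that the desubstituted prefix is strictly shorter.\<close>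
    have s_gt: "Suc n < s (Suc n)" for n
    proof (induction n)
      case 0
      show ?case using first_block by (simp add: s_0 s_Suc)
    next
      case (Suc n)
      then show ?case using s_less[of "Suc n"] by simp
    qed
    have mN: "m < N" using m(1) False s_gt by (cases m) (auto intro: less_le_trans)
    define r where "r = N - s m"
    have N: "N = s m + r" and r: "r \<le> K"
      using m s_Suc[of m] block_le[of m] by (simp_all add: r_def)
    have "cmod (\<Sum>i<r. f (y (s m + i))) \<le> (\<Sum>i<r. l1norm p f)"
      by (rule order_trans[OF norm_sum sum_mono]) (rule norm_le_l1norm)
    also have "\<dots> \<le> K * l1norm p f" using r by (simp add: mult_right_mono l1norm_nonneg)
    finally have rest: "cmod (\<Sum>i<r. f (y (s m + i))) \<le> K * l1norm p f" .
    have "cmod (\<Sum>i<N. f (y i)) \<le> cmod (\<Sum>j<m. ?T f (y j)) + cmod (\<Sum>i<r. f (y (s m + i)))"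
      unfolding N sum_lessThan_add sum_blocks by (rule norm_triangle_ineq)
    also have "\<dots> \<le> K * (\<Sum>n<m. l1norm p ((?T ^^ n) (?T f))) + K * l1norm p f"
      by (intro add_mono less.IH mN rest)
    also have "\<dots> = K * (\<Sum>n<Suc m. l1norm p ((?T ^^ n) f))"
      unfolding sum.lessThan_Suc_shift by (simp add: funpow_swap1 algebra_simps)
    also have "\<dots> \<le> K * (\<Sum>n<N. l1norm p ((?T ^^ n) f))"
      using mN by (intro mult_left_mono sum_mono2) (auto simp: l1norm_nonneg)
    finally show ?thesis .
  qed simp
qed

lemma summable_orbit_bounded:
  assumes "summable_orbit p \<sigma> f"
  shows "\<exists>C. \<forall>N. cmod (\<Sum>i<N. f (y i)) \<le> C"
proof -
  obtain B where B: "\<And>N. (\<Sum>n<N. l1norm p ((subst_op p \<sigma> ^^ n) f)) \<le> B"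
    using assms by (auto simp: summable_orbit_def)
  have "cmod (\<Sum>i<N. f (y i)) \<le> K * B" for N
    by (rule order_trans[OF norm_sum_le]) (intro mult_left_mono B of_nat_0_le_iff)
  then show ?thesis by blast
qed

lemma bounded_discrepancy:
  fixes h :: "nat \<Rightarrow> real"
  assumes "ultimately_pisot p \<sigma>"
  shows "\<exists>c C. \<forall>N. \<bar>(\<Sum>i<N. h (y i)) - c * real N\<bar> \<le> C"
proof -
  obtain \<phi> where add: "\<And>f g. \<phi> (\<lambda>l. f l + g l) = \<phi> f + \<phi> g"
    and scale: "\<And>c f. \<phi> (\<lambda>l. c * f l) = c * \<phi> f"
    and ker: "\<And>f. \<phi> f = 0 \<Longrightarrow> summable_orbit p \<sigma> f"
    by (rule stable_hyperplane[OF assms]) (rule that)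
  let ?one = "\<lambda>_. 1 :: complex" and ?h = "\<lambda>l. complex_of_real (h l)"
  have "\<not> summable_orbit p \<sigma> ?one"
  proof
    assume "summable_orbit p \<sigma> ?one"
    from summable_orbit_bounded[OF this] obtain C where "\<forall>N. real N \<le> C" by auto
    then show False using reals_Archimedean2[of C] by (meson not_le)
  qed
  then have one: "\<phi> ?one \<noteq> 0" using ker by blast
  \<comment> \<open>The multiple of the constant weight whose removal puts \<open>h\<close> into the
    kernel of \<phi>.\<close>
  define c where "c = \<phi> ?h / \<phi> ?one"
  have "\<phi> (\<lambda>l. ?h l + - c * ?one l) = 0"
    unfolding add scale using one by (simp add: c_def)
  from summable_orbit_bounded[OF ker[OF this]] obtain C
    where C: "\<And>N. cmod (\<Sum>i<N. ?h (y i) + - c * 1) \<le> C" by blast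
  \<comment> \<open>A priori \<open>c\<close> is complex; since \<open>h\<close> is real, taking
    real parts suffices.\<close>
  have "\<bar>(\<Sum>i<N. h (y i)) - Re c * real N\<bar> \<le> C" for N
  proof -
    have "(\<Sum>i<N. h (y i)) - Re c * real N = Re (\<Sum>i<N. ?h (y i) + - c * 1)"
      by (simp add: sum_subtractf)
    then show ?thesis using order_trans[OF abs_Re_le_cmod C] by simp
  qed
  then show ?thesis by blast
qed

text \<open>Here \<open>t\<close> cuts \<open>z\<close> into blocks whose lengths and sums depend only on the letters of \<open>y\<close>;
  the blocks may be those of any power of the substitution.\<close>

lemma bounded_discrepancy_blocks:
  fixes z :: "nat \<Rightarrow> real" and g :: "nat \<Rightarrow> real" and len t :: "nat \<Rightarrow> nat" and K' :: nat
  assumes up: "ultimately_pisot p \<sigma>"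
    and t_0: "t 0 = 0" and t_Suc: "\<And>m. t (Suc m) = t m + len (y m)"
    and len: "\<And>m. 0 < len (y m)" "\<And>m. len (y m) \<le> K'"
    and z: "\<And>i. \<bar>z i\<bar> \<le> 1"
    and block_sum: "\<And>m. (\<Sum>i<len (y m). z (t m + i)) = g (y m)"
  shows "\<exists>c C. \<forall>N. \<bar>(\<Sum>i<N. z i) - c * real N\<bar> \<le> C"
proof -
  \<comment> \<open>Here \<kappa> and \<open>L\<close> are the mean block sum and the mean block
    length per letter of \<open>y\<close>, so the mean of \<open>z\<close> should be their
    quotient.\<close>
  obtain \<kappa> C\<^sub>1 where \<kappa>: "\<And>m. \<bar>(\<Sum>j<m. g (y j)) - \<kappa> * real m\<bar> \<le> C\<^sub>1"
    using bounded_discrepancy[OF up] by blast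
  obtain L C\<^sub>2 where L': "\<And>m. \<bar>(\<Sum>j<m. real (len (y j))) - L * real m\<bar> \<le> C\<^sub>2"
    using bounded_discrepancy[OF up, of "\<lambda>l. real (len l)"] by blast
  have "real (t m) = (\<Sum>j<m. real (len (y j)))" for m
    by (induction m) (simp_all add: t_0 t_Suc)
  then have L: "\<bar>real (t m) - L * real m\<bar> \<le> C\<^sub>2" for m using L' by simp
  have z_blocks: "(\<Sum>i<t m. z i) = (\<Sum>j<m. g (y j))" for m
    by (induction m) (simp_all add: t_0 t_Suc sum_lessThan_add block_sum)
  have t_ge: "m \<le> t m" for m
  proof (induction m)
    case (Suc m)
    then show ?case using len(1)[of m] by (simp add: t_Suc)
  qed simp
  \<comment> \<open>A smaller \<open>L\<close> would let \<open>L * real m\<close> fall arbitrarily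
    far below \<open>t m\<close>. This justifies dividing by \<open>L\<close>.\<close>
  have "L \<ge> 1"
  proof (rule ccontr)
    assume "\<not> L \<ge> 1"
    then obtain m :: nat where "C\<^sub>2 < real m * (1 - L)" using reals_Archimedean3[of "1 - L"] by auto
    then show False using L[of m] t_ge[of m] by (simp add: algebra_simps)
  qed
  define c where "c = \<kappa> / L"
  have "\<bar>(\<Sum>i<N. z i) - c * real N\<bar> \<le> real K' + C\<^sub>1 + \<bar>c\<bar> * C\<^sub>2 + \<bar>c\<bar> * real K'" for N
  proof -
    have "t m < t (Suc m)" for m using len(1) by (simp add: t_Suc)
    then obtain m where m: "t m \<le> N" "N < t (Suc m)" using block_index[of t N] t_0 by blast
    define r where "r = N - t m"
    have N: "N = t m + r" and r: "r \<le> K'"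
      using m t_Suc[of m] len(2)[of m] by (simp_all add: r_def)
    have "\<bar>\<Sum>i<r. z (t m + i)\<bar> \<le> (\<Sum>i<r. 1)"
      by (rule order_trans[OF sum_abs sum_mono]) (rule z)
    then have 1: "\<bar>\<Sum>i<r. z (t m + i)\<bar> \<le> real K'" using r by simp
    have 2: "\<bar>c * (L * real m - real (t m))\<bar> \<le> \<bar>c\<bar> * C\<^sub>2"
      unfolding abs_mult using L[of m] by (intro mult_left_mono) auto
    have 3: "\<bar>c * real r\<bar> \<le> \<bar>c\<bar> * real K'"
      unfolding abs_mult using r by (intro mult_left_mono) auto
    have "c * L = \<kappa>" using \<open>L \<ge> 1\<close> by (simp add: c_def)
    \<comment> \<open>Four errors: values in the partial block, discrepancy of the block sums,
      discrepancy of the block lengths, and length of the partial block.\<close>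
    then have "(\<Sum>i<N. z i) - c * real N = (\<Sum>i<r. z (t m + i))
        + ((\<Sum>j<m. g (y j)) - \<kappa> * real m) + c * (L * real m - real (t m)) - c * real r"
      unfolding N sum_lessThan_add z_blocks by (simp add: algebra_simps)
    then show ?thesis using 1 2 3 \<kappa>[of m] by linarith
  qed
  then show ?thesis by blast
qed

end

section \<open>Words and factors\<close>

lemma subst_word_Nil [simp]: "subst_word \<sigma> [] = []"
  by (simp add: subst_word_def)

lemma subst_word_Cons: "subst_word \<sigma> (b # w) = \<sigma> b @ subst_word \<sigma> w"
  by (simp add: subst_word_def)

lemma subst_word_append: "subst_word \<sigma> (u @ v) = subst_word \<sigma> u @ subst_word \<sigma> v"
  by (simp add: subst_word_def)

lemma subst_word_pow_Nil [simp]: "(subst_word \<tau> ^^ n) [] = []"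
  by (induction n) simp_all

lemma subst_word_pow_append:
  "(subst_word \<tau> ^^ n) (u @ v) = (subst_word \<tau> ^^ n) u @ (subst_word \<tau> ^^ n) v"
  by (induction n) (simp_all add: subst_word_append)

text \<open>A power is itself a substitution, so facts about fixed words and their blocks apply to
  it.\<close>

lemma subst_word_pow: "subst_word (\<lambda>b. (subst_word \<tau> ^^ n) [b]) w = (subst_word \<tau> ^^ n) w"
proof (induction w)
  case (Cons b w)
  then show ?case using subst_word_pow_append[of n \<tau> "[b]" w] by (simp add: subst_word_Cons)
qed simp

section \<open>Infinite words fixed by a substitution\<close>

text \<open>Invariance is expressed through prefixes because \<open>subst_word\<close> acts on
  finite lists.\<close>

definition fixes_word :: "(nat \<Rightarrow> nat list) \<Rightarrow> (nat \<Rightarrow> nat) \<Rightarrow> bool" where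
  "fixes_word \<sigma> x \<longleftrightarrow> (\<forall>m. \<exists>N. subst_word \<sigma> (map x [0..<m]) = map x [0..<N])"

definition block_pos :: "(nat \<Rightarrow> nat list) \<Rightarrow> (nat \<Rightarrow> nat) \<Rightarrow> nat \<Rightarrow> nat" where
  "block_pos \<sigma> x m = length (subst_word \<sigma> (map x [0..<m]))"

lemma block_pos_0 [simp]: "block_pos \<sigma> x 0 = 0"
  by (simp add: block_pos_def)

lemma block_pos_Suc: "block_pos \<sigma> x (Suc m) = block_pos \<sigma> x m + length (\<sigma> (x m))"
  by (simp add: block_pos_def subst_word_append subst_word_Cons)

lemma fixes_word_prefix:
  assumes "fixes_word \<sigma> x"
  shows "subst_word \<sigma> (map x [0..<m]) = map x [0..<block_pos \<sigma> x m]"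
proof -
  obtain N where N: "subst_word \<sigma> (map x [0..<m]) = map x [0..<N]"
    using assms by (auto simp: fixes_word_def)
  then show ?thesis by (simp add: block_pos_def)
qed

lemma fixes_word_segment:
  assumes "fixes_word \<sigma> x"
  shows "subst_word \<sigma> (map x [m..<m + n]) = map x [block_pos \<sigma> x m..<block_pos \<sigma> x (m + n)]"
proof -
  let ?b = "block_pos \<sigma> x"
  have "?b m \<le> ?b (m + n)" by (induction n) (simp_all add: block_pos_Suc)
  then have "map x [0..<?b m] @ map x [?b m..<?b (m + n)] = map x [0..<?b (m + n)]"
    by (metis le_add_diff_inverse map_append upt_add_eq_append zero_le)
  also have "\<dots> = subst_word \<sigma> (map x [0..<m] @ map x [m..<m + n])"
    unfolding fixes_word_prefix[OF assms, symmetric] by (simp add: upt_add_eq_append[symmetric] flip: map_append)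
  also have "\<dots> = map x [0..<?b m] @ subst_word \<sigma> (map x [m..<m + n])"
    unfolding subst_word_append fixes_word_prefix[OF assms] ..
  finally show ?thesis by simp
qed

text \<open>The image of the pair at \<open>m\<close> is a segment of \<open>x\<close>, and the
  window fits inside it. Hence a factor starting in block \<open>m\<close> can be read off from that
  pair alone.\<close>

lemma fixes_word_factor:
  assumes "fixes_word \<sigma> x" and "i + q \<le> length (\<sigma> (x m)) + length (\<sigma> (x (Suc m)))"
  shows "take q (drop i (subst_word \<sigma> (factor x m 2))) = factor x (block_pos \<sigma> x m + i) q"
  using assms(2) unfolding factor_def fixes_word_segment[OF assms(1)]
  by (simp add: block_pos_Suc drop_map take_map numeral_2_eq_2 add.assoc)

lemma fixes_word_pow:
  assumes "fixes_word \<tau> x"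
  shows "fixes_word (\<lambda>b. (subst_word \<tau> ^^ n) [b]) x"
  unfolding fixes_word_def subst_word_pow
proof (induction n)
  case (Suc n)
  show ?case
  proof
    fix m
    obtain N where "(subst_word \<tau> ^^ n) (map x [0..<m]) = map x [0..<N]" using Suc by blast
    then have "(subst_word \<tau> ^^ Suc n) (map x [0..<m]) = map x [0..<block_pos \<tau> x N]"
      by (simp add: fixes_word_prefix[OF assms])
    then show "\<exists>N. (subst_word \<tau> ^^ Suc n) (map x [0..<m]) = map x [0..<N]" by blast
  qed
qed auto

lemma set_subst_word_pow:
  assumes "is_subst d \<tau>" and "set w \<subseteq> {0..<d}"
  shows "set ((subst_word \<tau> ^^ n) w) \<subseteq> {0..<d}"
proof (induction n)
  case (Suc n)
  show ?case
  proof
    fix c assume "c \<in> set ((subst_word \<tau> ^^ Suc n) w)"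
    then obtain b where "b \<in> set ((subst_word \<tau> ^^ n) w)" "c \<in> set (\<tau> b)"
      by (auto simp: subst_word_def)
    then show "c \<in> {0..<d}" using Suc assms(1) by (fastforce simp: is_subst_def)
  qed
qed (use assms in simp)

lemma length_subst_word_ge:
  "(\<And>b. b \<in> set w \<Longrightarrow> r \<le> length (\<sigma> b)) \<Longrightarrow> r * length w \<le> length (subst_word \<sigma> w)"
  by (induction w) (fastforce simp: subst_word_Cons)+

lemma fixpoint_word_prefix:
  assumes "is_fixpoint_word \<tau> a x"
  shows "(subst_word \<tau> ^^ n) [a] = map x [0..<length ((subst_word \<tau> ^^ n) [a])]"
  using assms by (intro nth_equalityI) (auto simp: is_fixpoint_word_def)

text \<open>Each step keeps the initial \<open>a\<close>, adds a nonempty word after it, and does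
  not shorten the rest, as images are nonempty.\<close>

lemma fixpoint_word_length:
  assumes sub: "is_subst d \<tau>" and a: "a < d" and prol: "prolongable \<tau> a"
  shows "n < length ((subst_word \<tau> ^^ n) [a])"
proof -
  obtain u where u: "\<tau> a = a # u" "u \<noteq> []" using prol by (auto simp: prolongable_def)
  have "\<exists>v. (subst_word \<tau> ^^ n) [a] = a # v \<and> n \<le> length v"
  proof (induction n)
    case (Suc n)
    then obtain v where v: "(subst_word \<tau> ^^ n) [a] = a # v" "n \<le> length v" by blast
    have "set v \<subseteq> {0..<d}" using set_subst_word_pow[OF sub, of "[a]" n] a v by simp
    then have "1 * length v \<le> length (subst_word \<tau> v)"
      using sub by (intro length_subst_word_ge) (fastforce simp: is_subst_def Suc_le_eq)
    then show ?case using u v by (cases u) (simp_all add: subst_word_Cons)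
  qed simp
  then show ?thesis by auto
qed

text \<open>The prefix of length \<open>m\<close> lies within the \<open>m\<close>-th iterate of
  \<open>a\<close>, whose image is the next iterate and again a prefix of \<open>x\<close>.\<close>

lemma fixpoint_word_fixes:
  assumes "is_subst d \<tau>" "a < d" "prolongable \<tau> a" "is_fixpoint_word \<tau> a x"
  shows "fixes_word \<tau> x"
  unfolding fixes_word_def
proof
  fix m
  define L where "L = length ((subst_word \<tau> ^^ m) [a])"
  let ?L' = "length ((subst_word \<tau> ^^ Suc m) [a])"
  have "m < L" unfolding L_def by (rule fixpoint_word_length[OF assms(1-3)])
  then have "[0..<L] = [0..<m] @ [m..<L]"
    by (metis le_add_diff_inverse less_imp_le upt_add_eq_append zero_le)
  then have "(subst_word \<tau> ^^ m) [a] = map x [0..<m] @ map x [m..<L]"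
    using fixpoint_word_prefix[OF assms(4), of m] unfolding L_def by (metis map_append)
  then have "(subst_word \<tau> ^^ Suc m) [a] = subst_word \<tau> (map x [0..<m]) @ subst_word \<tau> (map x [m..<L])"
    by (simp add: subst_word_append)
  then have "subst_word \<tau> (map x [0..<m]) = take (block_pos \<tau> x m) (map x [0..<?L'])"
    and "block_pos \<tau> x m \<le> ?L'"
    unfolding fixpoint_word_prefix[OF assms(4), of "Suc m", symmetric] by (simp_all add: block_pos_def)
  then show "\<exists>N. subst_word \<tau> (map x [0..<m]) = map x [0..<N]" by (auto simp: take_map)
qed

lemma fixpoint_word_letter:
  assumes "is_subst d \<tau>" "a < d" "prolongable \<tau> a" "is_fixpoint_word \<tau> a x"
  shows "x i < d"
proof -
  have "x i \<in> set ((subst_word \<tau> ^^ i) [a])"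
    using fixpoint_word_length[OF assms(1-3), of i] assms(4) by (auto simp: is_fixpoint_word_def in_set_conv_nth)
  then show ?thesis using set_subst_word_pow[OF assms(1), of "[a]" i] assms(2) by auto
qed

section \<open>Powers of the incidence matrix and growth\<close>

lemma count_list_subst_word:
  "set w \<subseteq> {..<d} \<Longrightarrow> count_list (subst_word \<tau> w) j = (\<Sum>l<d. count_list w l * count_list (\<tau> l) j)"
  using sum_list_count[of w d "\<lambda>l. count_list (\<tau> l) j"]
  by (simp add: subst_word_def count_list_concat o_def)

lemma incidence_mat_pow:
  assumes sub: "is_subst d \<tau>" and "i < d" "j < d"
  shows "(incidence_mat d \<tau> ^\<^sub>m n) $$ (i, j) = int (count_list ((subst_word \<tau> ^^ n) [i]) j)"
  using assms(3)
proof (induction n arbitrary: j)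
  case 0
  then show ?case using assms(2) by (simp add: incidence_mat_def)
next
  case (Suc n)
  let ?M = "incidence_mat d \<tau>"
  have M: "?M \<in> carrier_mat d d" by (simp add: incidence_mat_def)
  then have Mn: "?M ^\<^sub>m n \<in> carrier_mat d d" by simp
  have w: "set ((subst_word \<tau> ^^ n) [i]) \<subseteq> {..<d}"
    using set_subst_word_pow[OF sub, of "[i]" n] assms(2) by auto
  have "(?M ^\<^sub>m Suc n) $$ (i, j) = (\<Sum>l<d. (?M ^\<^sub>m n) $$ (i, l) * ?M $$ (l, j))"
    using M Mn assms(2) Suc.prems by (simp add: scalar_prod_def lessThan_atLeast0)
  also have "\<dots> = (\<Sum>l<d. int (count_list ((subst_word \<tau> ^^ n) [i]) l) * int (count_list (\<tau> l) j))"
    using Suc by (intro sum.cong) (auto simp: incidence_mat_def)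
  also have "\<dots> = int (count_list ((subst_word \<tau> ^^ Suc n) [i]) j)"
    using count_list_subst_word[OF w, of \<tau> j] by simp
  finally show ?case .
qed

text \<open>Primitivity places \<open>a\<close> in the \<open>q\<close>-th image of every letter,
  and one more step expands it. So the power \<open>r = Suc q\<close> at least doubles
  lengths.\<close>

lemma primitive_growth:
  assumes sub: "is_subst d \<tau>" and a: "a < d" and prol: "prolongable \<tau> a" and prim: "primitive_subst d \<tau>"
  shows "\<exists>n. \<forall>b<d. k \<le> length ((subst_word \<tau> ^^ n) [b])"
proof -
  obtain q where q: "\<And>i j. i < d \<Longrightarrow> j < d \<Longrightarrow> (incidence_mat d \<tau> ^\<^sub>m q) $$ (i, j) > 0"
    using prim by (auto simp: primitive_subst_def primitive_mat_def incidence_mat_def)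
  define r where "r = Suc q"
  have two: "2 \<le> length ((subst_word \<tau> ^^ r) [b])" if b: "b < d" for b
  proof -
    let ?w = "(subst_word \<tau> ^^ q) [b]"
    have "count_list ?w a > 0" using q[OF b a] incidence_mat_pow[OF sub b a, of q] by simp
    then have "a \<in> set ?w" by (metis count_notin less_irrefl)
    then obtain u v where "?w = u @ a # v" by (meson split_list)
    moreover have "2 \<le> length (\<tau> a)" using prol by (auto simp: prolongable_def Suc_le_eq)
    ultimately show ?thesis by (simp add: r_def subst_word_append subst_word_Cons)
  qed
  have "k \<le> length ((subst_word \<tau> ^^ (r * k)) [b])" if b: "b < d" for b
  proof (induction k)
    case (Suc k)
    show ?case
    \<comment> \<open>Doubling a lower bound \<open>k\<close> reaches \<open>Suc k\<close> only for
      positive \<open>k\<close>; the case 0 starts from \<open>two\<close>.\<close>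
    proof (cases k)
      case 0
      then show ?thesis using two[OF b] by simp
    next
      case (Suc k')
      let ?w = "(subst_word \<tau> ^^ (r * k)) [b]"
      have "set ?w \<subseteq> {0..<d}" using set_subst_word_pow[OF sub, of "[b]" "r * k"] b by simp
      then have "2 * length ?w \<le> length (subst_word (\<lambda>c. (subst_word \<tau> ^^ r) [c]) ?w)"
        by (intro length_subst_word_ge) (auto simp: two)
      also have "\<dots> = length ((subst_word \<tau> ^^ (r * Suc k)) [b])"
        unfolding subst_word_pow by (simp add: funpow_add)
      finally show ?thesis using Suc.IH Suc by simp
    qed
  qed simp
  then show ?thesis by blast
qed

section \<open>Numbering the factors of length two\<close>

lemma finite_factors:
  assumes "\<And>i. x i < d"
  shows "finite (factors x n)"
proof (rule finite_subset)
  show "factors x n \<subseteq> {w. set w \<subseteq> {..<d} \<and> length w = n}"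
    using assms by (auto simp: factors_def factor_def)
  show "finite {w. set w \<subseteq> {..<d} \<and> length w = n}" by (rule finite_lists_length_eq) simp
qed

lemma factor_first_occ:
  assumes "w \<in> factors x n"
  shows "factor x (first_occ x w) n = w"
proof -
  obtain i where i: "factor x i n = w" using assms by (auto simp: factors_def)
  then have "length w = n" by (auto simp: factor_def)
  then show ?thesis using i unfolding first_occ_def by (metis (mono_tags, lifting) LeastI)
qed

lemma Theta2_less:
  assumes "finite (factors x 2)" and "w \<in> factors x 2"
  shows "Theta2 x w < num_factors2 x"
  unfolding Theta2_def num_factors2_def
  by (rule psubset_card_mono[OF assms(1)]) (use assms(2) in blast)

text \<open>Ranks increase strictly with the first occurrence, and two pairs first occurring at the
  same position coincide.\<close>

lemma Theta2_inj:
  assumes fin: "finite (factors x 2)"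
  shows "inj_on (Theta2 x) (factors x 2)"
proof -
  have less: "Theta2 x v < Theta2 x w" if "v \<in> factors x 2" "first_occ x v < first_occ x w" for v w
    unfolding Theta2_def using fin that by (intro psubset_card_mono) (auto intro: less_trans)
  show ?thesis
  proof
    fix v w assume vw: "v \<in> factors x 2" "w \<in> factors x 2" "Theta2 x v = Theta2 x w"
    then have "first_occ x v = first_occ x w" using less by (metis less_irrefl linorder_neqE_nat)
    then show "v = w" using vw factor_first_occ by metis
  qed
qed

text \<open>The image of a pair under \<open>tau2\<close> spells the pairs starting inside the image
  of its first letter. The last of these reaches into the next image, which must therefore be
  nonempty.\<close>

lemma tau2_blocks:
  assumes fixed: "fixes_word \<tau> x" and fin: "finite (factors x 2)" and ne: "\<tau> (x (Suc m)) \<noteq> []"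
  shows "tau2 \<tau> x (Theta2 x (factor x m 2))
    = map (\<lambda>j. Theta2 x (factor x (block_pos \<tau> x m + j) 2)) [0..<length (\<tau> (x m))]"
proof -
  have "factor x m 2 \<in> factors x 2" by (auto simp: factors_def)
  then have inv: "the_inv_into (factors x 2) (Theta2 x) (Theta2 x (factor x m 2)) = factor x m 2"
    by (rule the_inv_into_f_f[OF Theta2_inj[OF fin]])
  have "factor x m 2 ! 0 = x m" by (simp add: factor_def)
  moreover have "take 2 (drop j (subst_word \<tau> (factor x m 2))) = factor x (block_pos \<tau> x m + j) 2"
    if "j < length (\<tau> (x m))" for j
  proof (rule fixes_word_factor[OF fixed])
    have "1 \<le> length (\<tau> (x (Suc m)))" using ne by (cases "\<tau> (x (Suc m))") auto
    then show "j + 2 \<le> length (\<tau> (x m)) + length (\<tau> (x (Suc m)))" using that by linarith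
  qed
  ultimately show ?thesis by (simp add: tau2_def inv Let_def)
qed

section \<open>Occurrence counts and classes of factors\<close>

text \<open>Occurrences are counted by their start in \<open>x\<close>. The interval is empty when
  \<open>w\<close> is longer than the factor.\<close>

lemma occ_factor:
  assumes "0 < length w"
  shows "occ (factor x i n) w = card {j \<in> {i..<i + n - (length w - 1)}. factor x j (length w) = w}"
  unfolding occ_def
proof (rule bij_betw_same_card[of "\<lambda>j. i + j"])
  let ?q = "length w"
  have "take ?q (drop j (factor x i n)) = factor x (i + j) ?q" if "j + ?q \<le> n" for j
    using that by (simp add: factor_def drop_map take_map add.assoc)
  moreover have "length (factor x i n) = n" by (simp add: factor_def)
  ultimately show "bij_betw (\<lambda>j. i + j)
      {j. j + ?q \<le> length (factor x i n) \<and> take ?q (drop j (factor x i n)) = w}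
      {j \<in> {i..<i + n - (?q - 1)}. factor x j ?q = w}"
    using assms by (intro bij_betw_byWitness[where f' = "\<lambda>j. j - i"])
      (auto simp: less_diff_conv simp del: length_greater_0_conv)
qed

text \<open>A count is a difference of two prefix sums, so it lies within \<open>2 * C\<close> of a
  value independent of \<open>i\<close>.\<close>

lemma occ_bounded_spread:
  assumes "0 < length w"
    and "\<And>N. \<bar>(\<Sum>j<N. of_bool (factor x j (length w) = w)) - c * real N\<bar> \<le> C"
  shows "\<bar>real (occ (factor x i n) w) - real (occ (factor x i' n) w)\<bar> \<le> 4 * C"
proof (cases "length w \<le> n")
  case True
  let ?h = "\<lambda>j. of_bool (factor x j (length w) = w) :: real"
  define r where "r = n - (length w - 1)"
  have "\<bar>real (occ (factor x i n) w) - c * real r\<bar> \<le> 2 * C" for i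
  proof -
    have "i + n - (length w - 1) = i + r" using True by (simp add: r_def)
    then have "real (occ (factor x i n) w) = (\<Sum>j\<in>{i..<i + r}. ?h j)"
      unfolding occ_factor[OF assms(1)] by (simp add: of_bool_def sum.If_cases Int_def)
    also have "\<dots> = (\<Sum>j<i + r. ?h j) - (\<Sum>j<i. ?h j)"
      using sum.atLeastLessThan_concat[of 0 i "i + r" ?h] by (simp add: lessThan_atLeast0 del: sum_of_bool_eq)
    finally show ?thesis using assms(2)[of "i + r"] assms(2)[of i] by (simp add: algebra_simps)
  qed
  from this[of i] this[of i'] show ?thesis by linarith
next
  case False
  then have "occ (factor x i n) w = 0" for i by (simp add: occ_def factor_def)
  \<comment> \<open>Both counts vanish; the empty prefix shows that \<open>C\<close> is
    nonnegative.\<close>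
  then show ?thesis using assms(2)[of 0] by simp
qed

lemma card_quotient_kernel_le:
  assumes "finite A"
  shows "card (A // {(u, v). u \<in> A \<and> v \<in> A \<and> \<Phi> u = \<Phi> v}) \<le> card (\<Phi> ` A)"
proof -
  have "A // {(u, v). u \<in> A \<and> v \<in> A \<and> \<Phi> u = \<Phi> v} \<subseteq> (\<lambda>t. {v \<in> A. t = \<Phi> v}) ` (\<Phi> ` A)"
    by (auto simp: quotient_def)
  then show ?thesis using assms by (meson card_image_le card_mono finite_imageI le_trans)
qed

text \<open>A class is determined by its counts of the finitely many words in \<open>W\<close>, and
  each count stays within \<open>D w\<close> of the one in the prefix of the same length.\<close>

lemma k_abelian_complexity_bounded:
  assumes x: "\<And>i. x i < d"
    and spread: "\<And>w. 0 < length w \<Longrightarrow> length w \<le> k \<Longrightarrow>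
      \<exists>C. \<forall>n i i'. \<bar>real (occ (factor x i n) w) - real (occ (factor x i' n) w)\<bar> \<le> C"
  shows "\<exists>C. \<forall>n. k_abelian_complexity k x n \<le> C"
proof -
  define W where "W = {w. set w \<subseteq> {..<d} \<and> length w \<le> k}"
  have finW: "finite W" unfolding W_def by (rule finite_lists_length_le) simp
  have "\<exists>C::nat. \<forall>n i i'. occ (factor x i n) w \<le> occ (factor x i' n) w + C" if "w \<in> W" for w
  \<comment> \<open>The empty word occurs \<open>n + 1\<close> times in every factor of length
    \<open>n\<close>.\<close>
  proof (cases "w = []")
    case True
    then show ?thesis by (simp add: occ_def factor_def)
  next
    case False
    then obtain C where C: "\<And>n i i'. \<bar>real (occ (factor x i n) w) - real (occ (factor x i' n) w)\<bar> \<le> C"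
      using spread[of w] \<open>w \<in> W\<close> by (auto simp: W_def)
    have "occ (factor x i n) w \<le> occ (factor x i' n) w + nat \<lceil>C\<rceil>" for n i i'
      using C[of i n i'] by linarith
    then show ?thesis by blast
  qed
  then obtain D where D: "\<And>w n i i'. w \<in> W \<Longrightarrow> occ (factor x i n) w \<le> occ (factor x i' n) w + D w"
    by metis
  have "k_abelian_complexity k x n \<le> (\<Prod>w\<in>W. 2 * D w + 1)" for n
  proof -
    define \<Phi> where "\<Phi> u = (\<lambda>w\<in>W. occ u w)" for u
    let ?F = "factors x n" and ?o = "\<lambda>w. occ (factor x 0 n) w"
    have finF: "finite ?F" by (rule finite_factors[OF x])
    have outside: "occ u w = 0" if "u \<in> ?F" "length w \<le> k" "w \<notin> W" for u w
    proof -
      have "set u \<subseteq> {..<d}" using that(1) x by (auto simp: factors_def factor_def)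
      then have "take (length w) (drop i u) \<noteq> w" for i
        using that(2,3) by (metis (mono_tags, lifting) W_def mem_Collect_eq set_drop_subset set_take_subset subset_trans)
      then show ?thesis by (simp add: occ_def)
    qed
    have "k_abelian_eq k u v \<longleftrightarrow> \<Phi> u = \<Phi> v" if "u \<in> ?F" "v \<in> ?F" for u v
    proof
      assume "k_abelian_eq k u v"
      then show "\<Phi> u = \<Phi> v" by (auto simp: \<Phi>_def k_abelian_eq_def W_def restrict_def fun_eq_iff)
    next
      assume eq: "\<Phi> u = \<Phi> v"
      have "occ u w = occ v w" if "w \<in> W" for w using fun_cong[OF eq, of w] that by (simp add: \<Phi>_def)
      then show "k_abelian_eq k u v" using outside that unfolding k_abelian_eq_def by metis
    qed
    then have "{(u, v). u \<in> ?F \<and> v \<in> ?F \<and> k_abelian_eq k u v} = {(u, v). u \<in> ?F \<and> v \<in> ?F \<and> \<Phi> u = \<Phi> v}"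
      by blast
    then have "k_abelian_complexity k x n \<le> card (\<Phi> ` ?F)"
      unfolding k_abelian_complexity_def using card_quotient_kernel_le[OF finF, of \<Phi>] by simp
    also have "\<dots> \<le> card (PiE W (\<lambda>w. {?o w - D w..?o w + D w}))"
    proof (rule card_mono)
      show "finite (PiE W (\<lambda>w. {?o w - D w..?o w + D w}))" by (rule finite_PiE[OF finW]) simp
      have "?o w - D w \<le> occ (factor x i n) w" if "w \<in> W" for i w
        using D[OF that, where i = 0 and i' = i and n = n] by simp
      then show "\<Phi> ` ?F \<subseteq> PiE W (\<lambda>w. {?o w - D w..?o w + D w})"
        using D by (auto simp: \<Phi>_def factors_def)
    qed
    also have "\<dots> = (\<Prod>w\<in>W. card {?o w - D w..?o w + D w})" by (rule card_PiE[OF finW])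
    also have "\<dots> \<le> (\<Prod>w\<in>W. 2 * D w + 1)" by (rule prod_mono) auto
    finally show ?thesis .
  qed
  then show ?thesis by blast
qed

section \<open>Bounded complexity via the pair coding\<close>

theorem theorem39:
  fixes d :: nat and \<tau> :: "nat \<Rightarrow> nat list" and a :: nat and x :: "nat \<Rightarrow> nat"
  assumes "is_subst d \<tau>"
    and "a < d"
    and "primitive_subst d \<tau>"
    and "prolongable \<tau> a"
    and "is_fixpoint_word \<tau> a x"
    and "ultimately_pisot (num_factors2 x) (tau2 \<tau> x)"
  shows "\<forall>k\<ge>1. \<exists>C. \<forall>n. k_abelian_complexity k x n \<le> C"
proof (intro allI impI)
  fix k :: nat
  note sub = assms(1) and fp = assms(1,2,4,5)
  have x: "x i < d" for i by (rule fixpoint_word_letter[OF fp])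
  have fixed: "fixes_word \<tau> x" by (rule fixpoint_word_fixes[OF fp])
  have fin: "finite (factors x 2)" by (rule finite_factors[OF x])
  have ne: "\<tau> (x m) \<noteq> []" for m using sub x by (simp add: is_subst_def)
  have len_le: "length (\<sigma> (x m)) \<le> (\<Sum>b<d. length (\<sigma> b))" for \<sigma> :: "nat \<Rightarrow> nat list" and m
    using x by (intro member_le_sum) auto
  define y where "y i = Theta2 x (factor x i 2)" for i
  \<comment> \<open>By injectivity of the numbering, a letter of \<open>y\<close> determines the
    pair and its first letter.\<close>
  have x_of_y: "x i = the_inv_into (factors x 2) (Theta2 x) (y i) ! 0"
    and pair_of_y: "factor x i 2 = the_inv_into (factors x 2) (Theta2 x) (y i)" for i
  proof -
    have "factor x i 2 \<in> factors x 2" by (auto simp: factors_def)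
    then show "factor x i 2 = the_inv_into (factors x 2) (Theta2 x) (y i)"
      unfolding y_def by (rule the_inv_into_f_f[OF Theta2_inj[OF fin], symmetric])
    then show "x i = the_inv_into (factors x 2) (Theta2 x) (y i) ! 0"
      by (metis add_0_right factor_def le_add1 nth_map_upt zero_less_numeral add_diff_cancel_left')
  qed
  have blocks: "tau2 \<tau> x (y m) = map (\<lambda>j. y (block_pos \<tau> x m + j)) [0..<length (\<tau> (x m))]" for m
    unfolding y_def by (rule tau2_blocks[OF fixed fin ne])
  have "x 0 = a" using assms(5) unfolding is_fixpoint_word_def by (metis funpow_0 length_Cons nth_Cons_0 zero_less_Suc)
  \<comment> \<open>\<open>y\<close> under \<open>tau2\<close> has the same block boundaries as
    \<open>x\<close> under \<tau>, and prolongability makes the first block long enough.\<close>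
  interpret fixed_blocks "num_factors2 x" "\<Sum>b<d. length (\<tau> b)" "tau2 \<tau> x" y "block_pos \<tau> x"
  proof
    fix i m
    show "y i < num_factors2 x"
      unfolding y_def by (rule Theta2_less[OF fin]) (auto simp: factors_def)
    show "block_pos \<tau> x 0 = 0" by simp
    show "block_pos \<tau> x (Suc m) = block_pos \<tau> x m + length (tau2 \<tau> x (y m))"
      by (simp add: blocks block_pos_Suc)
    show "i < length (tau2 \<tau> x (y m)) \<Longrightarrow> y (block_pos \<tau> x m + i) = tau2 \<tau> x (y m) ! i"
      by (simp add: blocks)
    show "tau2 \<tau> x (y m) \<noteq> []" using ne by (simp add: blocks)
    show "length (tau2 \<tau> x (y m)) \<le> (\<Sum>b<d. length (\<tau> b))" by (simp add: blocks len_le)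
    show "2 \<le> length (tau2 \<tau> x (y 0))"
      using assms(4) \<open>x 0 = a\<close> by (auto simp: blocks prolongable_def Suc_le_eq)
  qed
  show "\<exists>C. \<forall>n. k_abelian_complexity k x n \<le> C"
  proof (rule k_abelian_complexity_bounded[OF x])
    fix w :: "nat list" assume w: "0 < length w" "length w \<le> k"
    \<comment> \<open>With images this long, an occurrence of \<open>w\<close> starting in one block
      ends no later than the next block.\<close>
    obtain n where n: "\<And>b. b < d \<Longrightarrow> k \<le> length ((subst_word \<tau> ^^ n) [b])"
      using primitive_growth[OF sub assms(2,4,3)] by blast
    define \<sigma> where "\<sigma> b = (subst_word \<tau> ^^ n) [b]" for b
    have fixed\<sigma>: "fixes_word \<sigma> x" unfolding \<sigma>_def by (rule fixes_word_pow[OF fixed])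
    have \<sigma>: "k \<le> length (\<sigma> (x m))" for m using n[OF x] by (simp add: \<sigma>_def)
    let ?q = "length w" and ?u = "the_inv_into (factors x 2) (Theta2 x)"
    \<comment> \<open>Counts the occurrences of \<open>w\<close> that start in the image of the
      first letter of the pair coded by \<open>l\<close>, read in the image of the whole
      pair.\<close>
    define g where
      "g l = (\<Sum>i<length (\<sigma> (?u l ! 0)). of_bool (take ?q (drop i (subst_word \<sigma> (?u l))) = w) :: real)" for l
    have "\<exists>c C. \<forall>N. \<bar>(\<Sum>j<N. of_bool (factor x j ?q = w)) - c * real N\<bar> \<le> C"
    proof (rule bounded_discrepancy_blocks[OF assms(6),
          where t = "block_pos \<sigma> x" and len = "\<lambda>l. length (\<sigma> (?u l ! 0))" and g = g
            and K' = "\<Sum>b<d. length (\<sigma> b)"])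
      show "block_pos \<sigma> x 0 = 0" by simp
      fix m
      show "block_pos \<sigma> x (Suc m) = block_pos \<sigma> x m + length (\<sigma> (?u (y m) ! 0))"
        unfolding x_of_y[symmetric] by (rule block_pos_Suc)
      show "0 < length (\<sigma> (?u (y m) ! 0))" unfolding x_of_y[symmetric] using \<sigma>[of m] w by linarith
      show "length (\<sigma> (?u (y m) ! 0)) \<le> (\<Sum>b<d. length (\<sigma> b))"
        unfolding x_of_y[symmetric] by (rule len_le)
      show "(\<Sum>i<length (\<sigma> (?u (y m) ! 0)). of_bool (factor x (block_pos \<sigma> x m + i) ?q = w)) = g (y m)"
        unfolding g_def x_of_y[symmetric] unfolding pair_of_y[symmetric]
      proof (rule sum.cong[OF refl])
        fix i assume "i \<in> {..<length (\<sigma> (x m))}"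
        then have "i + ?q \<le> length (\<sigma> (x m)) + length (\<sigma> (x (Suc m)))"
          using \<sigma>[of "Suc m"] w by simp
        from fixes_word_factor[OF fixed\<sigma> this]
        show "of_bool (factor x (block_pos \<sigma> x m + i) ?q = w)
            = (of_bool (take ?q (drop i (subst_word \<sigma> (factor x m 2))) = w) :: real)" by simp
      qed
    qed simp
    then obtain c C where "\<And>N. \<bar>(\<Sum>j<N. of_bool (factor x j ?q = w)) - c * real N\<bar> \<le> C" by blast
    from occ_bounded_spread[OF w(1) this]
    show "\<exists>C. \<forall>n i i'. \<bar>real (occ (factor x i n) w) - real (occ (factor x i' n) w)\<bar> \<le> C" by blast
  qed
qed

end
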